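(* Let $\mathcal{D}_h$ be a sound abstraction of $\mathcal{D}_l$ relative to a refinement mapping $m$. Then for any ground high-level action sequence $\vec\alpha$ and any high-level situation-suppressed formula $\phi$: if $\mathcal{D}_h\models Executable(do(\vec\alpha,S_0))\land\phi[do(\vec\alpha,S_0)]$, then $\mathcal{D}_l\cup\mathcal{C}\models\exists s.\,Do(m(\vec\alpha),S_0,s)\land m(\phi)[s]$.
   Context: Situation calculus setting. Objects are a countably infinite set $\mathcal{N}$ of standard names (unique names and domain closure); no function symbols other than constants; no non-fluent predicates. Situations: $S_0$ and $do(a,s)$; $do([a_1,\dots,a_n],s)$ abbreviates $do(a_n,\dots,do(a_1,s)\dots)$, also written $do(\vec a,s)$. $Poss(a,s)$ means $a$ is executable in $s$; $Executable(s)$ means every action along the history from $S_0$ to $s$ was possible where performed. A basic action theory (BAT) over finitely many action types $\mathcal{A}$ and fluents $\mathcal{F}$ consists of initial-state axioms $\mathcal{D}_{S_0}$, precondition axioms $Poss(A(\vec x),s)\equiv\phi^{Poss}_A(\vec x,s)$, successor state axioms $F(\vec x,do(a,s))\equiv\phi^{ssa}_F(\vec x,a,s)$ (right-hand sides uniform in $s$), unique names/domain closure axioms for actions $\mathcal{D}_{ca}$ and for objects $\mathcal{D}_{coa}$, and foundational axioms $\Sigma$. A situation-suppressed formula omits situation arguments of fluents; $\phi[s]$ restores $s$. ConGolog programs $\delta::=\alpha\mid\varphi?\mid\delta_1;\delta_2\mid\delta_1|\delta_2\mid\pi x.\delta\mid\delta^*\mid\delta_1\|\delta_2$, $nil=True?$;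 $\mathcal{C}$ are the axioms: $Trans(\alpha,s,\delta',s')\equiv s'=do(\alpha,s)\land Poss(\alpha,s)\land\delta'=True?$; $Trans(\varphi?,s,\delta',s')\equiv False$; $Trans(\delta_1;\delta_2,s,\delta',s')\equiv\exists\delta_1'(Trans(\delta_1,s,\delta_1',s')\land\delta'=\delta_1';\delta_2)\lor(Final(\delta_1,s)\land Trans(\delta_2,s,\delta',s'))$; $Trans(\delta_1|\delta_2,\cdot)\equiv Trans(\delta_1,\cdot)\lor Trans(\delta_2,\cdot)$; $Trans(\pi x.\delta,s,\delta',s')\equiv\exists x.Trans(\delta,s,\delta',s')$; $Trans(\delta^*,s,\delta',s')\equiv\exists\delta''(Trans(\delta,s,\delta'',s')\land\delta'=\delta'';\delta^* )$; $Trans(\delta_1\|\delta_2,s,\delta',s')\equiv\exists\delta_1'(Trans(\delta_1,s,\delta_1',s')\land\delta'=\delta_1'\|\delta_2)\lor\exists\delta_2'(Trans(\delta_2,s,\delta_2',s')\land\delta'=\delta_1\|\delta_2')$; $Final(\alpha,s)\equiv False$; $Final(\varphi?,s)\equiv\varphi[s]$; $Final(\delta_1;\delta_2,s)\equiv Final(\delta_1,s)\land Final(\delta_2,s)$; $Final(\delta_1|\delta_2,s)\equiv Final(\delta_1,s)\lor Final(\delta_2,s)$; $Final(\pi x.\delta,s)\equiv\exists x.Final(\delta,s)$; $Final(\delta^*,s)\equiv True$; $Final(\delta_1\|\delta_2,s)\equiv Final(\delta_1,s)\land Final(\delta_2,s)$. $Do(\delta,s,s')\doteq\exists\delta'.Trans^*(\delta,s,\delta',s')\land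 Final(\delta',s')$, $Trans^*$ the reflexive transitive closure. $\mathcal{D}_h$ (high-level) and $\mathcal{D}_l$ (low-level) are BATs with action types $\mathcal{A}_h,\mathcal{A}_l$ and fluents $\mathcal{F}_h,\mathcal{F}_l$, sharing only $\mathcal{N}$. A refinement mapping $m$ maps each $A\in\mathcal{A}_h$ to a situation-determined ConGolog program $m(A(\vec x))$ over $\mathcal{D}_l$ with free variables $\vec x$, and each $F\in\mathcal{F}_h$ to a situation-suppressed low-level formula $m(F(\vec x))$; $m(\phi)$ substitutes $m(F(\vec x))$ for fluent atoms; $m(\alpha_1,\dots,\alpha_n)=m(\alpha_1);\dots;m(\alpha_n)$, $m(\epsilon)=nil$. For a model $M_h$ of $\mathcal{D}_h$ and a model $M_l$ of $\mathcal{D}_l\cup\mathcal{C}$: $s_h\simeq_m^{M_h,M_l}s_l$ iff for all $F\in\mathcal{F}_h$ and assignments $v$, $M_h,v[s/s_h]\models F(\vec x,s)$ iff $M_l,v[s/s_l]\models m(F(\vec x))[s]$. A relation $B$ between situation domains is an $m$-bisimulation if each $\langle s_h,s_l\rangle\in B$ satisfies: (1) $s_h\simeq_m^{M_h,M_l}s_l$; (2) for each $A\in\mathcal{A}_h$ and $v$, if some $s_h'$ has $M_h,v[s/s_h,s'/s_h']\models Poss(A(\vec x),s)\land s'=do(A(\vec x),s)$ then some $s_l'$ has $M_l,v[s/s_l,s'/s_l']\models Do(m(A(\vec x)),s,s')$ and $\langle s_h',s_l'\rangle\in B$; (3) conversely, if some $s_l'$ has $M_l,v[s/s_l,s'/s_l']\models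 Do(m(A(\vec x)),s,s')$ then some $s_h'$ has $M_h,v[s/s_h,s'/s_h']\models Poss(A(\vec x),s)\land s'=do(A(\vec x),s)$ and $\langle s_h',s_l'\rangle\in B$. $M_h\sim_m M_l$ iff some $m$-bisimulation contains $\langle S_0^{M_h},S_0^{M_l}\rangle$. $\mathcal{D}_h$ is a sound abstraction of $\mathcal{D}_l$ relative to $m$ iff for every model $M_l$ of $\mathcal{D}_l\cup\mathcal{C}$ there is a model $M_h$ of $\mathcal{D}_h$ with $M_h\sim_m M_l$. *)

theory Defs
  imports Complex_Main "HOL-Library.Countable" "HOL-Library.Infinite_Typeclass"
begin

section \<open>Syntax\<close>

text \<open>
  Standard names are the elements of a type \<open>'n\<close>; action types and fluents are
  taken from \<open>'A\<close> and \<open>'F\<close>.  Variables are de Bruijn indices.  In a formula or program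
  with parameters \<open>x\<^sub>0, \<dots>, x\<^sub>k\<^sub>-\<^sub>1\<close>, the parameter \<open>x\<^sub>i\<close> is the free variable \<open>Var i\<close>.
\<close>

datatype 'n tm = Var nat | Name 'n

text \<open>Situation-suppressed formulas. The remaining connectives are definable.\<close>

datatype ('F, 'n) fml =
    Tru
  | Fluent 'F "'n tm list"
  | Eq "'n tm" "'n tm"
  | Neg "('F, 'n) fml"
  | Conj "('F, 'n) fml" "('F, 'n) fml"
  | All "('F, 'n) fml"

text \<open>
  The formulas uniform in a situation that occur in the axioms of an action theory. They may
  also speak about actions, which a successor state axiom needs. The two sorts of variables
  are indexed independently: \<open>UAll\<close> binds an object and \<open>UAllAct\<close> an action variable.
\<close>

datatype ('A, 'n) atm = AVar nat | ATerm 'A "'n tm list"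

datatype ('A, 'F, 'n) ufml =
    UTru
  | UFluent 'F "'n tm list"
  | UEq "'n tm" "'n tm"
  | UEqAct "('A, 'n) atm" "('A, 'n) atm"
  | UNeg "('A, 'F, 'n) ufml"
  | UConj "('A, 'F, 'n) ufml" "('A, 'F, 'n) ufml"
  | UAll "('A, 'F, 'n) ufml"
  | UAllAct "('A, 'F, 'n) ufml"

text \<open>ConGolog programs; \<open>Pick\<close> is \<open>\<pi>x.\<delta>\<close> and binds an object variable.\<close>

datatype ('A, 'F, 'n) prog =
    Prim 'A "'n tm list"
  | Test "('F, 'n) fml"
  | Seq "('A, 'F, 'n) prog" "('A, 'F, 'n) prog"
  | Choice "('A, 'F, 'n) prog" "('A, 'F, 'n) prog"
  | Pick "('A, 'F, 'n) prog"
  | Star "('A, 'F, 'n) prog"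
  | Par "('A, 'F, 'n) prog" "('A, 'F, 'n) prog"

abbreviation nil :: "('A, 'F, 'n) prog" where
  "nil \<equiv> Test Tru"

fun tsubst :: "(nat \<Rightarrow> 'n tm) \<Rightarrow> 'n tm \<Rightarrow> 'n tm" where
  "tsubst \<sigma> (Var i) = \<sigma> i"
| "tsubst \<sigma> (Name n) = Name n"

definition lift_subst :: "(nat \<Rightarrow> 'n tm) \<Rightarrow> nat \<Rightarrow> 'n tm" where
  "lift_subst \<sigma> = case_nat (Var 0) (\<lambda>i. tsubst (\<lambda>j. Var (Suc j)) (\<sigma> i))"

fun fsubst :: "(nat \<Rightarrow> 'n tm) \<Rightarrow> ('F, 'n) fml \<Rightarrow> ('F, 'n) fml" where
  "fsubst \<sigma> Tru = Tru"
| "fsubst \<sigma> (Fluent F ts) = Fluent F (map (tsubst \<sigma>) ts)"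
| "fsubst \<sigma> (Eq t u) = Eq (tsubst \<sigma> t) (tsubst \<sigma> u)"
| "fsubst \<sigma> (Neg \<phi>) = Neg (fsubst \<sigma> \<phi>)"
| "fsubst \<sigma> (Conj \<phi> \<psi>) = Conj (fsubst \<sigma> \<phi>) (fsubst \<sigma> \<psi>)"
| "fsubst \<sigma> (All \<phi>) = All (fsubst (lift_subst \<sigma>) \<phi>)"

fun psubst :: "(nat \<Rightarrow> 'n tm) \<Rightarrow> ('A, 'F, 'n) prog \<Rightarrow> ('A, 'F, 'n) prog" where
  "psubst \<sigma> (Prim A ts) = Prim A (map (tsubst \<sigma>) ts)"
| "psubst \<sigma> (Test \<phi>) = Test (fsubst \<sigma> \<phi>)"
| "psubst \<sigma> (Seq \<delta>1 \<delta>2) = Seq (psubst \<sigma> \<delta>1) (psubst \<sigma> \<delta>2)"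
| "psubst \<sigma> (Choice \<delta>1 \<delta>2) = Choice (psubst \<sigma> \<delta>1) (psubst \<sigma> \<delta>2)"
| "psubst \<sigma> (Pick \<delta>) = Pick (psubst (lift_subst \<sigma>) \<delta>)"
| "psubst \<sigma> (Star \<delta>) = Star (psubst \<sigma> \<delta>)"
| "psubst \<sigma> (Par \<delta>1 \<delta>2) = Par (psubst \<sigma> \<delta>1) (psubst \<sigma> \<delta>2)"

text \<open>The substitution that replaces the outermost variable by the name \<open>n\<close>.\<close>

abbreviation inst_name :: "'n \<Rightarrow> nat \<Rightarrow> 'n tm" where
  "inst_name n \<equiv> case_nat (Name n) Var"

text \<open>The substitution of the terms \<open>ts\<close> for the parameters \<open>x\<^sub>0, x\<^sub>1, \<dots>\<close>.\<close>

definition params :: "'n tm list \<Rightarrow> nat \<Rightarrow> 'n tm" where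
  "params ts i = (if i < length ts then ts ! i else Var i)"

section \<open>Signatures and basic action theories\<close>

record ('A, 'F) sig =
  actions :: "'A set"
  fluents :: "'F set"
  act_ar :: "'A \<Rightarrow> nat"
  flu_ar :: "'F \<Rightarrow> nat"

text \<open>
  \<open>wf_fml S k\<close>, \<open>wf_prog S k\<close> and \<open>wf_ufml S k l\<close>: well-formed over the signature \<open>S\<close>, with all
  free object variables below \<open>k\<close> (and all free action variables below \<open>l\<close>).
\<close>

fun wf_tm :: "nat \<Rightarrow> 'n tm \<Rightarrow> bool" where
  "wf_tm k (Var i) \<longleftrightarrow> i < k"
| "wf_tm k (Name n) \<longleftrightarrow> True"

fun wf_fml :: "('A, 'F, 'z) sig_scheme \<Rightarrow> nat \<Rightarrow> ('F, 'n) fml \<Rightarrow> bool" where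
  "wf_fml S k Tru \<longleftrightarrow> True"
| "wf_fml S k (Fluent F ts) \<longleftrightarrow>
     F \<in> fluents S \<and> length ts = flu_ar S F \<and> (\<forall>t \<in> set ts. wf_tm k t)"
| "wf_fml S k (Eq t u) \<longleftrightarrow> wf_tm k t \<and> wf_tm k u"
| "wf_fml S k (Neg \<phi>) \<longleftrightarrow> wf_fml S k \<phi>"
| "wf_fml S k (Conj \<phi> \<psi>) \<longleftrightarrow> wf_fml S k \<phi> \<and> wf_fml S k \<psi>"
| "wf_fml S k (All \<phi>) \<longleftrightarrow> wf_fml S (Suc k) \<phi>"

fun wf_atm :: "('A, 'F, 'z) sig_scheme \<Rightarrow> nat \<Rightarrow> nat \<Rightarrow> ('A, 'n) atm \<Rightarrow> bool" where
  "wf_atm S k l (AVar j) \<longleftrightarrow> j < l"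
| "wf_atm S k l (ATerm A ts) \<longleftrightarrow>
     A \<in> actions S \<and> length ts = act_ar S A \<and> (\<forall>t \<in> set ts. wf_tm k t)"

fun wf_ufml :: "('A, 'F, 'z) sig_scheme \<Rightarrow> nat \<Rightarrow> nat \<Rightarrow> ('A, 'F, 'n) ufml \<Rightarrow> bool" where
  "wf_ufml S k l UTru \<longleftrightarrow> True"
| "wf_ufml S k l (UFluent F ts) \<longleftrightarrow>
     F \<in> fluents S \<and> length ts = flu_ar S F \<and> (\<forall>t \<in> set ts. wf_tm k t)"
| "wf_ufml S k l (UEq t u) \<longleftrightarrow> wf_tm k t \<and> wf_tm k u"
| "wf_ufml S k l (UEqAct a b) \<longleftrightarrow> wf_atm S k l a \<and> wf_atm S k l b"
| "wf_ufml S k l (UNeg \<phi>) \<longleftrightarrow> wf_ufml S k l \<phi>"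
| "wf_ufml S k l (UConj \<phi> \<psi>) \<longleftrightarrow> wf_ufml S k l \<phi> \<and> wf_ufml S k l \<psi>"
| "wf_ufml S k l (UAll \<phi>) \<longleftrightarrow> wf_ufml S (Suc k) l \<phi>"
| "wf_ufml S k l (UAllAct \<phi>) \<longleftrightarrow> wf_ufml S k (Suc l) \<phi>"

fun wf_prog :: "('A, 'F, 'z) sig_scheme \<Rightarrow> nat \<Rightarrow> ('A, 'F, 'n) prog \<Rightarrow> bool" where
  "wf_prog S k (Prim A ts) \<longleftrightarrow>
     A \<in> actions S \<and> length ts = act_ar S A \<and> (\<forall>t \<in> set ts. wf_tm k t)"
| "wf_prog S k (Test \<phi>) \<longleftrightarrow> wf_fml S k \<phi>"
| "wf_prog S k (Seq \<delta>1 \<delta>2) \<longleftrightarrow> wf_prog S k \<delta>1 \<and> wf_prog S k \<delta>2"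
| "wf_prog S k (Choice \<delta>1 \<delta>2) \<longleftrightarrow> wf_prog S k \<delta>1 \<and> wf_prog S k \<delta>2"
| "wf_prog S k (Pick \<delta>) \<longleftrightarrow> wf_prog S (Suc k) \<delta>"
| "wf_prog S k (Star \<delta>) \<longleftrightarrow> wf_prog S k \<delta>"
| "wf_prog S k (Par \<delta>1 \<delta>2) \<longleftrightarrow> wf_prog S k \<delta>1 \<and> wf_prog S k \<delta>2"

text \<open>A ground action \<open>A(n\<^sub>1, \<dots>, n\<^sub>k)\<close> is the pair of \<open>A\<close> and the list of its arguments.\<close>

definition ground_action :: "('A, 'F, 'z) sig_scheme \<Rightarrow> 'A \<times> 'n list \<Rightarrow> bool" where
  "ground_action S \<alpha> \<longleftrightarrow> fst \<alpha> \<in> actions S \<and> length (snd \<alpha>) = act_ar S (fst \<alpha>)"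

text \<open>
  The variable part of a basic action theory: the initial-state axioms and the right-hand sides
  of the precondition and successor state axioms. In the latter the action variable \<open>a\<close>
  is \<open>AVar 0\<close>.
\<close>

record ('A, 'F, 'n) bat = "('A, 'F) sig" +
  init_axs :: "('A, 'F, 'n) ufml set"
  poss_rhs :: "'A \<Rightarrow> ('A, 'F, 'n) ufml"
  ssa_rhs :: "'F \<Rightarrow> ('A, 'F, 'n) ufml"

definition is_bat :: "('A, 'F, 'n) bat \<Rightarrow> bool" where
  "is_bat D \<longleftrightarrow>
     finite (actions D) \<and> finite (fluents D) \<and>
     (\<forall>\<phi> \<in> init_axs D. wf_ufml D 0 0 \<phi>) \<and>
     (\<forall>A \<in> actions D. wf_ufml D (act_ar D A) 0 (poss_rhs D A)) \<and>
     (\<forall>F \<in> fluents D. wf_ufml D (flu_ar D F) 1 (ssa_rhs D F))"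

section \<open>Structures and models\<close>

text \<open>
  The object domain is the set of standard names itself, so that the object axioms hold by
  construction and an assignment of the object variables can be shared by structures for
  different signatures. The domains of actions and situations are arbitrary subsets
  of a universe \<open>'u\<close>. Unique names and domain closure for actions together with second-order
  induction on situations make both domains of a model countable, hence every
  model has an isomorphic copy in any infinite \<open>'u\<close>.
\<close>

record ('A, 'F, 'n, 'u) interp =
  Act :: "'u set"
  Sit :: "'u set"
  act :: "'A \<Rightarrow> 'n list \<Rightarrow> 'u"
  S0 :: "'u"
  doS :: "'u \<Rightarrow> 'u \<Rightarrow> 'u"
  prec :: "'u \<Rightarrow> 'u \<Rightarrow> bool"
  Poss :: "'u \<Rightarrow> 'u \<Rightarrow> bool"
  flu :: "'F \<Rightarrow> 'n list \<Rightarrow> 'u \<Rightarrow> bool"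

fun tval :: "(nat \<Rightarrow> 'n) \<Rightarrow> 'n tm \<Rightarrow> 'n" where
  "tval v (Var i) = v i"
| "tval v (Name n) = n"

text \<open>\<open>sat M v s \<phi>\<close> is \<open>M, v \<Turnstile> \<phi>[s]\<close>.\<close>

fun sat :: "('A, 'F, 'n, 'u, 'z) interp_scheme \<Rightarrow> (nat \<Rightarrow> 'n) \<Rightarrow> 'u \<Rightarrow> ('F, 'n) fml \<Rightarrow> bool" where
  "sat M v s Tru \<longleftrightarrow> True"
| "sat M v s (Fluent F ts) \<longleftrightarrow> flu M F (map (tval v) ts) s"
| "sat M v s (Eq t u) \<longleftrightarrow> tval v t = tval v u"
| "sat M v s (Neg \<phi>) \<longleftrightarrow> \<not> sat M v s \<phi>"
| "sat M v s (Conj \<phi> \<psi>) \<longleftrightarrow> sat M v s \<phi> \<and> sat M v s \<psi>"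
| "sat M v s (All \<phi>) \<longleftrightarrow> (\<forall>n. sat M (case_nat n v) s \<phi>)"

fun aval :: "('A, 'F, 'n, 'u, 'z) interp_scheme \<Rightarrow> (nat \<Rightarrow> 'n) \<Rightarrow> (nat \<Rightarrow> 'u) \<Rightarrow> ('A, 'n) atm \<Rightarrow> 'u" where
  "aval M v w (AVar j) = w j"
| "aval M v w (ATerm A ts) = act M A (map (tval v) ts)"

fun usat :: "('A, 'F, 'n, 'u, 'z) interp_scheme \<Rightarrow> (nat \<Rightarrow> 'n) \<Rightarrow> (nat \<Rightarrow> 'u) \<Rightarrow> 'u
    \<Rightarrow> ('A, 'F, 'n) ufml \<Rightarrow> bool" where
  "usat M v w s UTru \<longleftrightarrow> True"
| "usat M v w s (UFluent F ts) \<longleftrightarrow> flu M F (map (tval v) ts) s"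
| "usat M v w s (UEq t u) \<longleftrightarrow> tval v t = tval v u"
| "usat M v w s (UEqAct a b) \<longleftrightarrow> aval M v w a = aval M v w b"
| "usat M v w s (UNeg \<phi>) \<longleftrightarrow> \<not> usat M v w s \<phi>"
| "usat M v w s (UConj \<phi> \<psi>) \<longleftrightarrow> usat M v w s \<phi> \<and> usat M v w s \<psi>"
| "usat M v w s (UAll \<phi>) \<longleftrightarrow> (\<forall>n. usat M (case_nat n v) w s \<phi>)"
| "usat M v w s (UAllAct \<phi>) \<longleftrightarrow> (\<forall>a \<in> Act M. usat M v (case_nat a w) s \<phi>)"

text \<open>The values of the parameters \<open>x\<^sub>0, \<dots>, x\<^sub>k\<^sub>-\<^sub>1\<close> under \<open>v\<close>.\<close>

abbreviation vals :: "(nat \<Rightarrow> 'n) \<Rightarrow> nat \<Rightarrow> 'n list" where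
  "vals v k \<equiv> map v [0..<k]"

definition well_sorted ::
    "('A, 'F, 'y) sig_scheme \<Rightarrow> ('A, 'F, 'n, 'u, 'z) interp_scheme \<Rightarrow> bool" where
  "well_sorted S M \<longleftrightarrow>
     S0 M \<in> Sit M \<and>
     (\<forall>a \<in> Act M. \<forall>s \<in> Sit M. doS M a s \<in> Sit M) \<and>
     (\<forall>\<alpha>. ground_action S \<alpha> \<longrightarrow> act M (fst \<alpha>) (snd \<alpha>) \<in> Act M)"

definition sat_foundational :: "('A, 'F, 'n, 'u, 'z) interp_scheme \<Rightarrow> bool" where
  "sat_foundational M \<longleftrightarrow>
     (\<forall>a \<in> Act M. \<forall>b \<in> Act M. \<forall>s \<in> Sit M. \<forall>t \<in> Sit M.
        doS M a s = doS M b t \<longrightarrow> a = b \<and> s = t) \<and>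
     (\<forall>P. P (S0 M) \<and> (\<forall>a \<in> Act M. \<forall>s \<in> Sit M. P s \<longrightarrow> P (doS M a s)) \<longrightarrow> (\<forall>s \<in> Sit M. P s)) \<and>
     (\<forall>s \<in> Sit M. \<not> prec M s (S0 M)) \<and>
     (\<forall>a \<in> Act M. \<forall>s \<in> Sit M. \<forall>t \<in> Sit M.
        prec M s (doS M a t) \<longleftrightarrow> prec M s t \<or> s = t)"

definition sat_act_axs ::
    "('A, 'F, 'y) sig_scheme \<Rightarrow> ('A, 'F, 'n, 'u, 'z) interp_scheme \<Rightarrow> bool" where
  "sat_act_axs S M \<longleftrightarrow>
     (\<forall>\<alpha> \<beta>. ground_action S \<alpha> \<and> ground_action S \<beta> \<and>
        act M (fst \<alpha>) (snd \<alpha>) = act M (fst \<beta>) (snd \<beta>) \<longrightarrow> \<alpha> = \<beta>) \<and>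
     (\<forall>a \<in> Act M. \<exists>\<alpha>. ground_action S \<alpha> \<and> a = act M (fst \<alpha>) (snd \<alpha>))"

definition sat_init :: "('A, 'F, 'n) bat \<Rightarrow> ('A, 'F, 'n, 'u, 'z) interp_scheme \<Rightarrow> bool" where
  "sat_init D M \<longleftrightarrow> (\<forall>\<phi> \<in> init_axs D. \<forall>v w. usat M v w (S0 M) \<phi>)"

definition sat_poss :: "('A, 'F, 'n) bat \<Rightarrow> ('A, 'F, 'n, 'u, 'z) interp_scheme \<Rightarrow> bool" where
  "sat_poss D M \<longleftrightarrow>
     (\<forall>A \<in> actions D. \<forall>v w. \<forall>s \<in> Sit M.
        Poss M (act M A (vals v (act_ar D A))) s \<longleftrightarrow> usat M v w s (poss_rhs D A))"

definition sat_ssa :: "('A, 'F, 'n) bat \<Rightarrow> ('A, 'F, 'n, 'u, 'z) interp_scheme \<Rightarrow> bool" where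
  "sat_ssa D M \<longleftrightarrow>
     (\<forall>F \<in> fluents D. \<forall>v. \<forall>a \<in> Act M. \<forall>s \<in> Sit M.
        flu M F (vals v (flu_ar D F)) (doS M a s) \<longleftrightarrow> usat M v (\<lambda>_. a) s (ssa_rhs D F))"

definition is_model :: "('A, 'F, 'n) bat \<Rightarrow> ('A, 'F, 'n, 'u, 'z) interp_scheme \<Rightarrow> bool" where
  "is_model D M \<longleftrightarrow>
     well_sorted D M \<and> sat_foundational M \<and> sat_act_axs D M \<and>
     sat_init D M \<and> sat_poss D M \<and> sat_ssa D M"

fun do_list :: "('A, 'F, 'n, 'u, 'z) interp_scheme \<Rightarrow> ('A \<times> 'n list) list \<Rightarrow> 'u \<Rightarrow> 'u" where
  "do_list M [] s = s"
| "do_list M (\<alpha> # \<alpha>s) s = do_list M \<alpha>s (doS M (act M (fst \<alpha>) (snd \<alpha>)) s)"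

definition Executable :: "('A, 'F, 'n, 'u, 'z) interp_scheme \<Rightarrow> 'u \<Rightarrow> bool" where
  "Executable M s \<longleftrightarrow>
     (\<forall>a \<in> Act M. \<forall>t \<in> Sit M. prec M (doS M a t) s \<or> doS M a t = s \<longrightarrow> Poss M a t)"

section \<open>ConGolog\<close>

text \<open>
  The domain of the program sort consists of the closed programs. A program with
  free variables is read under an assignment \<open>v\<close> as its instance \<open>psubst (Name \<circ> v)\<close>.
\<close>

record ('A, 'F, 'n, 'u) cinterp = "('A, 'F, 'n, 'u) interp" +
  Trans :: "('A, 'F, 'n) prog \<Rightarrow> 'u \<Rightarrow> ('A, 'F, 'n) prog \<Rightarrow> 'u \<Rightarrow> bool"
  Final :: "('A, 'F, 'n) prog \<Rightarrow> 'u \<Rightarrow> bool"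

definition well_sorted_C ::
    "('A, 'F, 'y) sig_scheme \<Rightarrow> ('A, 'F, 'n, 'u, 'z) cinterp_scheme \<Rightarrow> bool" where
  "well_sorted_C S M \<longleftrightarrow>
     (\<forall>\<delta> s \<delta>' s'. Trans M \<delta> s \<delta>' s' \<longrightarrow>
        wf_prog S 0 \<delta> \<and> s \<in> Sit M \<and> wf_prog S 0 \<delta>' \<and> s' \<in> Sit M) \<and>
     (\<forall>\<delta> s. Final M \<delta> s \<longrightarrow> wf_prog S 0 \<delta> \<and> s \<in> Sit M)"

definition sat_trans_axs ::
    "('A, 'F, 'y) sig_scheme \<Rightarrow> ('A, 'F, 'n, 'u, 'z) cinterp_scheme \<Rightarrow> bool" where
  "sat_trans_axs S M \<longleftrightarrow>
     (\<forall>s \<in> Sit M. \<forall>s' \<in> Sit M. \<forall>\<delta>'. wf_prog S 0 \<delta>' \<longrightarrow>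
        (\<forall>A ns. wf_prog S 0 (Prim A (map Name ns)) \<longrightarrow>
           (Trans M (Prim A (map Name ns)) s \<delta>' s' \<longleftrightarrow>
              s' = doS M (act M A ns) s \<and> Poss M (act M A ns) s \<and> \<delta>' = nil)) \<and>
        (\<forall>\<phi>. wf_prog S 0 (Test \<phi>) \<longrightarrow>
           (Trans M (Test \<phi>) s \<delta>' s' \<longleftrightarrow> False)) \<and>
        (\<forall>\<delta>1 \<delta>2. wf_prog S 0 (Seq \<delta>1 \<delta>2) \<longrightarrow>
           (Trans M (Seq \<delta>1 \<delta>2) s \<delta>' s' \<longleftrightarrow>
              (\<exists>\<delta>1'. Trans M \<delta>1 s \<delta>1' s' \<and> \<delta>' = Seq \<delta>1' \<delta>2) \<or>
              (Final M \<delta>1 s \<and> Trans M \<delta>2 s \<delta>' s'))) \<and>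
        (\<forall>\<delta>1 \<delta>2. wf_prog S 0 (Choice \<delta>1 \<delta>2) \<longrightarrow>
           (Trans M (Choice \<delta>1 \<delta>2) s \<delta>' s' \<longleftrightarrow>
              Trans M \<delta>1 s \<delta>' s' \<or> Trans M \<delta>2 s \<delta>' s')) \<and>
        (\<forall>\<delta>. wf_prog S 0 (Pick \<delta>) \<longrightarrow>
           (Trans M (Pick \<delta>) s \<delta>' s' \<longleftrightarrow>
              (\<exists>n. Trans M (psubst (inst_name n) \<delta>) s \<delta>' s'))) \<and>
        (\<forall>\<delta>. wf_prog S 0 (Star \<delta>) \<longrightarrow>
           (Trans M (Star \<delta>) s \<delta>' s' \<longleftrightarrow>
              (\<exists>\<delta>''. Trans M \<delta> s \<delta>'' s' \<and> \<delta>' = Seq \<delta>'' (Star \<delta>)))) \<and>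
        (\<forall>\<delta>1 \<delta>2. wf_prog S 0 (Par \<delta>1 \<delta>2) \<longrightarrow>
           (Trans M (Par \<delta>1 \<delta>2) s \<delta>' s' \<longleftrightarrow>
              (\<exists>\<delta>1'. Trans M \<delta>1 s \<delta>1' s' \<and> \<delta>' = Par \<delta>1' \<delta>2) \<or>
              (\<exists>\<delta>2'. Trans M \<delta>2 s \<delta>2' s' \<and> \<delta>' = Par \<delta>1 \<delta>2'))))"

definition sat_final_axs ::
    "('A, 'F, 'y) sig_scheme \<Rightarrow> ('A, 'F, 'n, 'u, 'z) cinterp_scheme \<Rightarrow> bool" where
  "sat_final_axs S M \<longleftrightarrow>
     (\<forall>s \<in> Sit M.
        (\<forall>A ts. wf_prog S 0 (Prim A ts) \<longrightarrow> (Final M (Prim A ts) s \<longleftrightarrow> False)) \<and>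
        (\<forall>\<phi> v. wf_prog S 0 (Test \<phi>) \<longrightarrow> (Final M (Test \<phi>) s \<longleftrightarrow> sat M v s \<phi>)) \<and>
        (\<forall>\<delta>1 \<delta>2. wf_prog S 0 (Seq \<delta>1 \<delta>2) \<longrightarrow>
           (Final M (Seq \<delta>1 \<delta>2) s \<longleftrightarrow> Final M \<delta>1 s \<and> Final M \<delta>2 s)) \<and>
        (\<forall>\<delta>1 \<delta>2. wf_prog S 0 (Choice \<delta>1 \<delta>2) \<longrightarrow>
           (Final M (Choice \<delta>1 \<delta>2) s \<longleftrightarrow> Final M \<delta>1 s \<or> Final M \<delta>2 s)) \<and>
        (\<forall>\<delta>. wf_prog S 0 (Pick \<delta>) \<longrightarrow>
           (Final M (Pick \<delta>) s \<longleftrightarrow> (\<exists>n. Final M (psubst (inst_name n) \<delta>) s))) \<and>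
        (\<forall>\<delta>. wf_prog S 0 (Star \<delta>) \<longrightarrow> (Final M (Star \<delta>) s \<longleftrightarrow> True)) \<and>
        (\<forall>\<delta>1 \<delta>2. wf_prog S 0 (Par \<delta>1 \<delta>2) \<longrightarrow>
           (Final M (Par \<delta>1 \<delta>2) s \<longleftrightarrow> Final M \<delta>1 s \<and> Final M \<delta>2 s)))"

text \<open>Models of an action theory together with the ConGolog axioms.\<close>

definition is_model_C :: "('A, 'F, 'n) bat \<Rightarrow> ('A, 'F, 'n, 'u, 'z) cinterp_scheme \<Rightarrow> bool" where
  "is_model_C D M \<longleftrightarrow>
     is_model D M \<and> well_sorted_C D M \<and> sat_trans_axs D M \<and> sat_final_axs D M"

definition trans_star :: "('A, 'F, 'n, 'u, 'z) cinterp_scheme \<Rightarrow> (nat \<Rightarrow> 'n)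
    \<Rightarrow> ('A, 'F, 'n) prog \<Rightarrow> 'u \<Rightarrow> ('A, 'F, 'n) prog \<Rightarrow> 'u \<Rightarrow> bool" where
  "trans_star M v \<delta> s \<delta>' s' \<longleftrightarrow>
     (\<lambda>(\<delta>, s) (\<delta>', s'). Trans M \<delta> s \<delta>' s')\<^sup>*\<^sup>* (psubst (Name \<circ> v) \<delta>, s) (\<delta>', s')"

text \<open>\<open>Do M v \<delta> s s'\<close> is \<open>M, v \<Turnstile> Do(\<delta>, s, s')\<close>.\<close>

definition Do :: "('A, 'F, 'n, 'u, 'z) cinterp_scheme \<Rightarrow> (nat \<Rightarrow> 'n)
    \<Rightarrow> ('A, 'F, 'n) prog \<Rightarrow> 'u \<Rightarrow> 'u \<Rightarrow> bool" where
  "Do M v \<delta> s s' \<longleftrightarrow> (\<exists>\<delta>'. trans_star M v \<delta> s \<delta>' s' \<and> Final M \<delta>' s')"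

text \<open>
  A program is situation-determined in \<open>s\<close> if the situation reached determines
  the remaining program.
\<close>

definition situation_determined :: "('A, 'F, 'n, 'u, 'z) cinterp_scheme \<Rightarrow> (nat \<Rightarrow> 'n)
    \<Rightarrow> ('A, 'F, 'n) prog \<Rightarrow> 'u \<Rightarrow> bool" where
  "situation_determined M v \<delta> s \<longleftrightarrow>
     (\<forall>s' \<delta>' \<delta>''. trans_star M v \<delta> s \<delta>' s' \<and> trans_star M v \<delta> s \<delta>'' s' \<longrightarrow> \<delta>' = \<delta>'')"

section \<open>Entailment\<close>

definition entails :: "('A, 'F, 'n) bat
    \<Rightarrow> (('A, 'F, 'n, 'u) interp \<Rightarrow> (nat \<Rightarrow> 'n) \<Rightarrow> bool) \<Rightarrow> bool" where
  "entails D P \<longleftrightarrow> (\<forall>M v. is_model D M \<longrightarrow> P M v)"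

definition entails_C :: "('A, 'F, 'n) bat
    \<Rightarrow> (('A, 'F, 'n, 'u) cinterp \<Rightarrow> (nat \<Rightarrow> 'n) \<Rightarrow> bool) \<Rightarrow> bool" where
  "entails_C D P \<longleftrightarrow> (\<forall>M v. is_model_C D M \<longrightarrow> P M v)"

section \<open>Refinement mappings\<close>

record ('Ah, 'Fh, 'Al, 'Fl, 'n) rmap =
  map_act :: "'Ah \<Rightarrow> ('Al, 'Fl, 'n) prog"
  map_flu :: "'Fh \<Rightarrow> ('Fl, 'n) fml"

definition refinement_mapping :: "'ul itself \<Rightarrow> ('Ah, 'Fh, 'n) bat \<Rightarrow> ('Al, 'Fl, 'n) bat
    \<Rightarrow> ('Ah, 'Fh, 'Al, 'Fl, 'n) rmap \<Rightarrow> bool" where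
  "refinement_mapping U Dh Dl m \<longleftrightarrow>
     (\<forall>A \<in> actions Dh. wf_prog Dl (act_ar Dh A) (map_act m A) \<and>
        entails_C Dl (\<lambda>(M :: ('Al, 'Fl, 'n, 'ul) cinterp) v.
          \<forall>s \<in> Sit M. situation_determined M v (map_act m A) s)) \<and>
     (\<forall>F \<in> fluents Dh. wf_fml Dl (flu_ar Dh F) (map_flu m F))"

fun m_fml :: "('Ah, 'Fh, 'Al, 'Fl, 'n) rmap \<Rightarrow> ('Fh, 'n) fml \<Rightarrow> ('Fl, 'n) fml" where
  "m_fml m Tru = Tru"
| "m_fml m (Fluent F ts) = fsubst (params ts) (map_flu m F)"
| "m_fml m (Eq t u) = Eq t u"
| "m_fml m (Neg \<phi>) = Neg (m_fml m \<phi>)"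
| "m_fml m (Conj \<phi> \<psi>) = Conj (m_fml m \<phi>) (m_fml m \<psi>)"
| "m_fml m (All \<phi>) = All (m_fml m \<phi>)"

definition m_ground :: "('Ah, 'Fh, 'Al, 'Fl, 'n) rmap \<Rightarrow> 'Ah \<times> 'n list \<Rightarrow> ('Al, 'Fl, 'n) prog" where
  "m_ground m \<alpha> = psubst (params (map Name (snd \<alpha>))) (map_act m (fst \<alpha>))"

fun m_seq :: "('Ah, 'Fh, 'Al, 'Fl, 'n) rmap \<Rightarrow> ('Ah \<times> 'n list) list \<Rightarrow> ('Al, 'Fl, 'n) prog" where
  "m_seq m [] = nil"
| "m_seq m [\<alpha>] = m_ground m \<alpha>"
| "m_seq m (\<alpha> # \<beta> # \<alpha>s) = Seq (m_ground m \<alpha>) (m_seq m (\<beta> # \<alpha>s))"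

section \<open>Bisimulation and sound abstraction\<close>

definition m_isomorphic :: "('Ah, 'Fh, 'n) bat \<Rightarrow> ('Ah, 'Fh, 'Al, 'Fl, 'n) rmap
    \<Rightarrow> ('Ah, 'Fh, 'n, 'uh) interp \<Rightarrow> ('Al, 'Fl, 'n, 'ul) cinterp \<Rightarrow> 'uh \<Rightarrow> 'ul \<Rightarrow> bool" where
  "m_isomorphic Dh m Mh Ml sh sl \<longleftrightarrow>
     (\<forall>F \<in> fluents Dh. \<forall>v.
        sat Mh v sh (Fluent F (map Var [0..<flu_ar Dh F])) \<longleftrightarrow> sat Ml v sl (map_flu m F))"

definition m_bisimulation :: "('Ah, 'Fh, 'n) bat \<Rightarrow> ('Ah, 'Fh, 'Al, 'Fl, 'n) rmap
    \<Rightarrow> ('Ah, 'Fh, 'n, 'uh) interp \<Rightarrow> ('Al, 'Fl, 'n, 'ul) cinterp \<Rightarrow> ('uh \<times> 'ul) set \<Rightarrow> bool" where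
  "m_bisimulation Dh m Mh Ml B \<longleftrightarrow>
     B \<subseteq> Sit Mh \<times> Sit Ml \<and>
     (\<forall>(sh, sl) \<in> B.
        m_isomorphic Dh m Mh Ml sh sl \<and>
        (\<forall>A \<in> actions Dh. \<forall>v. let a = act Mh A (vals v (act_ar Dh A)) in
           (\<forall>sh' \<in> Sit Mh. Poss Mh a sh \<and> sh' = doS Mh a sh \<longrightarrow>
              (\<exists>sl' \<in> Sit Ml. Do Ml v (map_act m A) sl sl' \<and> (sh', sl') \<in> B)) \<and>
           (\<forall>sl' \<in> Sit Ml. Do Ml v (map_act m A) sl sl' \<longrightarrow>
              (\<exists>sh' \<in> Sit Mh. Poss Mh a sh \<and> sh' = doS Mh a sh \<and> (sh', sl') \<in> B))))"

definition m_bisimilar :: "('Ah, 'Fh, 'n) bat \<Rightarrow> ('Ah, 'Fh, 'Al, 'Fl, 'n) rmap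
    \<Rightarrow> ('Ah, 'Fh, 'n, 'uh) interp \<Rightarrow> ('Al, 'Fl, 'n, 'ul) cinterp \<Rightarrow> bool" where
  "m_bisimilar Dh m Mh Ml \<longleftrightarrow> (\<exists>B. m_bisimulation Dh m Mh Ml B \<and> (S0 Mh, S0 Ml) \<in> B)"

definition sound_abstraction :: "'uh itself \<Rightarrow> 'ul itself \<Rightarrow> ('Ah, 'Fh, 'n) bat
    \<Rightarrow> ('Al, 'Fl, 'n) bat \<Rightarrow> ('Ah, 'Fh, 'Al, 'Fl, 'n) rmap \<Rightarrow> bool" where
  "sound_abstraction Uh Ul Dh Dl m \<longleftrightarrow>
     (\<forall>Ml :: ('Al, 'Fl, 'n, 'ul) cinterp. is_model_C Dl Ml \<longrightarrow>
        (\<exists>Mh :: ('Ah, 'Fh, 'n, 'uh) interp. is_model Dh Mh \<and> m_bisimilar Dh m Mh Ml))"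

end

theory Submission
  imports Defs
begin

text \<open>
  Soundness supplies, for a low-level model, a bisimilar high-level model. There the action
  sequence is executable, so the forth condition can be applied once per action; the
  low-level executions obtained in this way compose to an execution of the
  translated sequence. Its last situation is bisimilar to the high-level one, and bisimilar
  situations agree on all formulas because they agree on the fluents.
\<close>

lemma tsubst_tsubst: "tsubst \<sigma> (tsubst \<tau> t) = tsubst (tsubst \<sigma> \<circ> \<tau>) t"
  by (cases t) auto

text \<open>Both sides fix index 0; at a successor it suffices that shifting variables commutes with
  substitution. This is the binder case (\<open>All\<close>, \<open>Pick\<close>) of the two
  composition laws below.\<close>

lemma lift_subst_comp:
  "tsubst (lift_subst \<sigma>) \<circ> lift_subst \<tau> = lift_subst (tsubst \<sigma> \<circ> \<tau>)"
proof
  fix i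
  show "(tsubst (lift_subst \<sigma>) \<circ> lift_subst \<tau>) i = lift_subst (tsubst \<sigma> \<circ> \<tau>) i"
  proof (cases i)
    case (Suc j)
    then show ?thesis by (cases "\<tau> j") (auto simp: lift_subst_def)
  qed (simp add: lift_subst_def)
qed

lemma fsubst_fsubst: "fsubst \<sigma> (fsubst \<tau> \<phi>) = fsubst (tsubst \<sigma> \<circ> \<tau>) \<phi>"
  by (induction \<phi> arbitrary: \<sigma> \<tau>) (auto simp: tsubst_tsubst lift_subst_comp)

lemma psubst_psubst: "psubst \<sigma> (psubst \<tau> \<delta>) = psubst (tsubst \<sigma> \<circ> \<tau>) \<delta>"
  by (induction \<delta> arbitrary: \<sigma> \<tau>) (auto simp: tsubst_tsubst fsubst_fsubst lift_subst_comp)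

lemma tval_tsubst: "tval v (tsubst \<sigma> t) = tval (tval v \<circ> \<sigma>) t"
  by (cases t) auto

text \<open>A shifted term does not see the value given to index 0. This settles the quantifier case
  of \<open>sat_fsubst\<close>.\<close>

lemma tval_lift_subst: "tval (case_nat n v) \<circ> lift_subst \<sigma> = case_nat n (tval v \<circ> \<sigma>)"
proof
  fix i
  show "(tval (case_nat n v) \<circ> lift_subst \<sigma>) i = case_nat n (tval v \<circ> \<sigma>) i"
  proof (cases i)
    case (Suc j)
    then show ?thesis by (cases "\<sigma> j") (auto simp: lift_subst_def)
  qed (simp add: lift_subst_def)
qed

lemma sat_fsubst: "sat M v s (fsubst \<sigma> \<phi>) \<longleftrightarrow> sat M (tval v \<circ> \<sigma>) s \<phi>"
proof (induction \<phi> arbitrary: \<sigma> v)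
  case (Fluent F ts)
  have "map (tval v \<circ> tsubst \<sigma>) ts = map (tval (tval v \<circ> \<sigma>)) ts"
    by (simp add: tval_tsubst)
  then show ?case by (simp del: comp_apply map_eq_conv)
qed (simp_all add: tval_tsubst tval_lift_subst)

text \<open>Only atoms need work: \<open>m_isomorphic\<close> covers them for variable arguments
  under every assignment. Connectives and quantifiers carry over because both structures have the
  same object domain.\<close>

lemma sat_m_fml:
  assumes "m_isomorphic Dh m Mh Ml sh sl" and "wf_fml Dh k \<phi>"
  shows "sat Ml v sl (m_fml m \<phi>) \<longleftrightarrow> sat Mh v sh \<phi>"
  using assms(2)
proof (induction \<phi> arbitrary: v k)
  case (Fluent F ts)
  \<comment> \<open>The arguments \<open>ts\<close> move into the assignment: \<open>?v\<close>
    gives each parameter the value of the corresponding term of \<open>ts\<close>.\<close>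
  let ?v = "tval v \<circ> params ts"
  have len: "length ts = flu_ar Dh F" and F: "F \<in> fluents Dh"
    using Fluent by auto
  have "sat Ml ?v sl (map_flu m F) \<longleftrightarrow>
      sat Mh ?v sh (Fluent F (map Var [0..<flu_ar Dh F]))"
    using assms(1) F unfolding m_isomorphic_def by blast
  moreover have "map (tval ?v) (map Var [0..<flu_ar Dh F]) = map (tval v) ts"
    by (rule nth_equalityI) (auto simp: len params_def)
  ultimately show ?case by (simp add: sat_fsubst del: map_map)
qed auto

text \<open>By the axiom for \<open>prec\<close>, the history of \<open>doS M a s\<close> is that of
  \<open>s\<close> extended by the step \<open>a\<close>.\<close>

lemma Executable_doS:
  assumes "sat_foundational M" and "a \<in> Act M" and "s \<in> Sit M"
    and "well_sorted D M" and "Executable M (doS M a s)"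
  shows "Poss M a s" and "Executable M s"
proof -
  show "Poss M a s" using assms unfolding Executable_def by blast
  have "prec M t (doS M a s) \<longleftrightarrow> prec M t s \<or> t = s" if "t \<in> Sit M" for t
    using assms(1-3) that unfolding sat_foundational_def by blast
  then show "Executable M s"
    using assms(4,5) unfolding Executable_def well_sorted_def by blast
qed

lemma Executable_do_list:
  assumes "sat_foundational M" and "well_sorted D M"
    and "s \<in> Sit M" and "\<forall>\<alpha> \<in> set \<alpha>s. ground_action D \<alpha>"
    and "Executable M (do_list M \<alpha>s s)"
  shows "Executable M s"
  using assms(3-5)
proof (induction \<alpha>s arbitrary: s)
  case (Cons \<alpha> \<alpha>s)
  let ?a = "act M (fst \<alpha>) (snd \<alpha>)"
  have a: "?a \<in> Act M" and s': "doS M ?a s \<in> Sit M"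
    using Cons.prems assms(2) unfolding well_sorted_def by auto
  have "Executable M (doS M ?a s)" using Cons.IH[OF s'] Cons.prems by simp
  then show ?case using Executable_doS(2)[OF assms(1) a _ assms(2)] Cons.prems(1) by blast
qed simp

text \<open>Each transition lifts by the first disjunct of the \<open>Seq\<close> axiom. That axiom
  speaks of closed well-formed programs only; \<open>well_sorted_C\<close> ensures that the run
  stays among them.\<close>

lemma trans_star_Seq:
  assumes "well_sorted_C S M" and "sat_trans_axs S M" and "wf_prog S 0 \<delta>2"
    and "(\<lambda>(\<delta>, s) (\<delta>', s'). Trans M \<delta> s \<delta>' s')\<^sup>*\<^sup>* (\<delta>1, s) (\<delta>1', s')"
  shows "(\<lambda>(\<delta>, s) (\<delta>', s'). Trans M \<delta> s \<delta>' s')\<^sup>*\<^sup>* (Seq \<delta>1 \<delta>2, s) (Seq \<delta>1' \<delta>2, s')"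
  using assms(4)
proof (induction rule: rtranclp_induct2)
  case (step \<delta>' t \<delta>'' t')
  then have tr: "Trans M \<delta>' t \<delta>'' t'" by simp
  then have "wf_prog S 0 \<delta>'" "t \<in> Sit M" "wf_prog S 0 \<delta>''" "t' \<in> Sit M"
    using assms(1) unfolding well_sorted_C_def by blast+
  then have "Trans M (Seq \<delta>' \<delta>2) t (Seq \<delta>'' \<delta>2) t'"
    using tr assms(2,3) unfolding sat_trans_axs_def by simp
  then show ?case using step.IH by (simp add: rtranclp.rtrancl_into_rtrancl)
qed simp

text \<open>The instantiated program either makes a first transition or is itself final, and
  \<open>well_sorted_C\<close> confines both relations to closed well-formed programs.\<close>

lemma Do_wf:
  assumes "well_sorted_C S M" and "Do M v \<delta> s s'"
  shows "wf_prog S 0 (psubst (Name \<circ> v) \<delta>)"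
proof -
  obtain \<delta>' where "(\<lambda>(\<delta>, s) (\<delta>', s'). Trans M \<delta> s \<delta>' s')\<^sup>*\<^sup>* (psubst (Name \<circ> v) \<delta>, s) (\<delta>', s')"
    and "Final M \<delta>' s'"
    using assms(2) unfolding Do_def trans_star_def by blast
  then show ?thesis
    using assms(1) unfolding well_sorted_C_def by (cases rule: converse_rtranclpE) auto
qed

text \<open>No silent transition leads from a finished first component to \<open>\<delta>2\<close>:
  control passes together with the first transition of \<open>\<delta>2\<close>. Hence the split by
  whether the second run is empty.\<close>

lemma Do_Seq:
  assumes ws: "well_sorted_C S M" and tr: "sat_trans_axs S M" and fin: "sat_final_axs S M"
    and do1: "Do M v \<delta>1 s s'" and do2: "Do M v \<delta>2 s' s''"
  shows "Do M v (Seq \<delta>1 \<delta>2) s s''"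
proof -
  let ?R = "\<lambda>(\<delta>, s) (\<delta>', s'). Trans M \<delta> s \<delta>' s'"
  let ?p = "psubst (Name \<circ> v)"
  note wf2 = Do_wf[OF ws do2]
  obtain \<delta>1' where 1: "?R\<^sup>*\<^sup>* (?p \<delta>1, s) (\<delta>1', s')" and f1: "Final M \<delta>1' s'"
    using do1 unfolding Do_def trans_star_def by blast
  obtain \<delta>2' where 2: "?R\<^sup>*\<^sup>* (?p \<delta>2, s') (\<delta>2', s'')" and f2: "Final M \<delta>2' s''"
    using do2 unfolding Do_def trans_star_def by blast
  have wf1: "wf_prog S 0 \<delta>1'" and s': "s' \<in> Sit M"
    using f1 ws unfolding well_sorted_C_def by blast+
  have seq1: "?R\<^sup>*\<^sup>* (Seq (?p \<delta>1) (?p \<delta>2), s) (Seq \<delta>1' (?p \<delta>2), s')"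
    by (rule trans_star_Seq[OF ws tr wf2 1])
  have "\<exists>\<delta>'. ?R\<^sup>*\<^sup>* (Seq \<delta>1' (?p \<delta>2), s') (\<delta>', s'') \<and> Final M \<delta>' s''"
    using 2
  proof (cases rule: converse_rtranclpE)
    case base
    then have "Final M (Seq \<delta>1' (?p \<delta>2)) s'"
      using f1 f2 fin wf1 wf2 s' unfolding sat_final_axs_def by simp
    then show ?thesis using base by auto
  next
    case (step y)
    obtain \<delta>3 t where y: "y = (\<delta>3, t)" by (cases y)
    with step have t: "Trans M (?p \<delta>2) s' \<delta>3 t" by simp
    then have "wf_prog S 0 \<delta>3" "t \<in> Sit M"
      using ws unfolding well_sorted_C_def by blast+
    \<comment> \<open>Second disjunct of the \<open>Seq\<close> axiom: as \<open>\<delta>1'\<close>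
      is final, it disappears and only \<open>\<delta>3\<close> remains to be run.\<close>
    then have "Trans M (Seq \<delta>1' (?p \<delta>2)) s' \<delta>3 t"
      using t tr f1 wf1 wf2 s' unfolding sat_trans_axs_def by simp
    then show ?thesis
      using step y f2 by (intro exI[of _ \<delta>2']) (auto intro: converse_rtranclp_into_rtranclp)
  qed
  then show ?thesis
    using seq1 unfolding Do_def trans_star_def by (auto intro: rtranclp_trans)
qed

text \<open>Bisimulations quantify over assignments, whereas \<open>m_seq\<close> instantiates
  ground actions. Composing the two substitutions turns ground arguments into values of the
  parameters.\<close>

lemma Do_m_ground:
  "Do M v (m_ground m (A, ns)) =
   Do M (\<lambda>i. if i < length ns then ns ! i else v i) (map_act m A)"
proof -
  have "tsubst (Name \<circ> v) \<circ> params (map Name ns) =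
      Name \<circ> (\<lambda>i. if i < length ns then ns ! i else v i)"
    by (auto simp: params_def)
  then show ?thesis
    by (intro ext) (simp add: Do_def trans_star_def m_ground_def psubst_psubst)
qed

lemma Do_m_ground_bisimulation:
  assumes "m_bisimulation Dh m Mh Ml B" and "(sh, sl) \<in> B" and "ground_action Dh \<alpha>"
    and "Poss Mh (act Mh (fst \<alpha>) (snd \<alpha>)) sh" and "doS Mh (act Mh (fst \<alpha>) (snd \<alpha>)) sh \<in> Sit Mh"
  shows "\<exists>sl' \<in> Sit Ml. Do Ml v (m_ground m \<alpha>) sl sl' \<and>
    (doS Mh (act Mh (fst \<alpha>) (snd \<alpha>)) sh, sl') \<in> B"
proof -
  obtain A ns where \<alpha>: "\<alpha> = (A, ns)" by (cases \<alpha>)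
  let ?v = "\<lambda>i. if i < length ns then ns ! i else v i"
  have A: "A \<in> actions Dh" and len: "length ns = act_ar Dh A"
    using assms(3) unfolding ground_action_def \<alpha> by auto
  \<comment> \<open>The arity is \<open>length ns\<close>, so only the first branch of
    \<open>?v\<close> is read.\<close>
  have vals: "vals ?v (act_ar Dh A) = ns"
    by (rule nth_equalityI) (auto simp: len)
  have "\<forall>sh' \<in> Sit Mh. Poss Mh (act Mh A (vals ?v (act_ar Dh A))) sh \<and>
      sh' = doS Mh (act Mh A (vals ?v (act_ar Dh A))) sh \<longrightarrow>
      (\<exists>sl' \<in> Sit Ml. Do Ml ?v (map_act m A) sl sl' \<and> (sh', sl') \<in> B)"
    using assms(1,2) A unfolding m_bisimulation_def Let_def by blast
  then show ?thesis
    using assms(4,5) unfolding vals Do_m_ground \<alpha> by simp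
qed

lemma Do_m_seq_bisimulation:
  assumes Mh: "is_model Dh Mh" and Ml: "is_model_C Dl Ml"
    and B: "m_bisimulation Dh m Mh Ml B" and "(sh, sl) \<in> B"
    and "\<forall>\<alpha> \<in> set \<alpha>s. ground_action Dh \<alpha>" and "Executable Mh (do_list Mh \<alpha>s sh)"
  shows "\<exists>sl' \<in> Sit Ml. Do Ml v (m_seq m \<alpha>s) sl sl' \<and> (do_list Mh \<alpha>s sh, sl') \<in> B"
proof -
  have ws: "well_sorted Dh Mh" and found: "sat_foundational Mh"
    using Mh unfolding is_model_def by auto
  have wsC: "well_sorted_C Dl Ml" and tr: "sat_trans_axs Dl Ml" and fin: "sat_final_axs Dl Ml"
    using Ml unfolding is_model_C_def by auto
  \<comment> \<open>Serves both nonempty cases of the induction below, hence the arbitrary pair and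
    remaining actions.\<close>
  have first: "\<exists>sl' \<in> Sit Ml. Do Ml v (m_ground m \<alpha>) sl sl' \<and>
      (doS Mh (act Mh (fst \<alpha>) (snd \<alpha>)) sh, sl') \<in> B"
    if "(sh, sl) \<in> B" "\<forall>\<beta> \<in> set (\<alpha> # \<alpha>s). ground_action Dh \<beta>"
      "Executable Mh (do_list Mh (\<alpha> # \<alpha>s) sh)" for sh sl \<alpha> \<alpha>s
  proof -
    let ?a = "act Mh (fst \<alpha>) (snd \<alpha>)"
    have sh: "sh \<in> Sit Mh" using that(1) B unfolding m_bisimulation_def by blast
    have a: "?a \<in> Act Mh" and s': "doS Mh ?a sh \<in> Sit Mh"
      using that(2) sh ws unfolding well_sorted_def by auto
    \<comment> \<open>Executability at the end of the sequence descends to the situation after its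
      first action, which makes that action possible.\<close>
    have "Executable Mh (doS Mh ?a sh)"
      using Executable_do_list[OF found ws s', of \<alpha>s] that(2,3) by simp
    then have "Poss Mh ?a sh" by (rule Executable_doS(1)[OF found a sh ws])
    then show ?thesis using Do_m_ground_bisimulation[OF B that(1) _ _ s'] that(2) by simp
  qed
  show ?thesis using assms(4-6)
  \<comment> \<open>The cases mirror the equations of \<open>m_seq\<close>, which puts no
    \<open>nil\<close> after the last action.\<close>
  proof (induction \<alpha>s arbitrary: sh sl rule: induct_list012)
    case 1
    then have sl: "sl \<in> Sit Ml" using B unfolding m_bisimulation_def by blast
    then have "Final Ml nil sl" using fin unfolding sat_final_axs_def
      by (metis sat.simps(1) wf_fml.simps(1) wf_prog.simps(2))
    then have "Do Ml v nil sl sl" unfolding Do_def trans_star_def by auto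
    then show ?case using 1 sl by auto
  next
    case (2 \<alpha>)
    then show ?case using first[of sh sl \<alpha> "[]"] by simp
  next
    case (3 \<alpha> \<beta> \<alpha>s)
    obtain sl' where sl': "Do Ml v (m_ground m \<alpha>) sl sl'"
      "(doS Mh (act Mh (fst \<alpha>) (snd \<alpha>)) sh, sl') \<in> B"
      using first[OF "3.prems"] by blast
    \<comment> \<open>The hypothesis for the tail \<open>\<beta> # \<alpha>s\<close>, taken at the
      pair reached after \<open>\<alpha>\<close>.\<close>
    with "3.IH"(2)[OF sl'(2)] "3.prems" obtain sl'' where "sl'' \<in> Sit Ml" "Do Ml v (m_seq m (\<beta> # \<alpha>s)) sl' sl''"
      "(do_list Mh (\<alpha> # \<beta> # \<alpha>s) sh, sl'') \<in> B"
      by auto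
    then show ?case using Do_Seq[OF wsC tr fin sl'(1)] by auto
  qed
qed

theorem theorem2:
  fixes Dh :: "('Ah, 'Fh, 'n :: {countable, infinite}) bat"
    and Dl :: "('Al, 'Fl, 'n) bat"
    and m :: "('Ah, 'Fh, 'Al, 'Fl, 'n) rmap"
    and \<alpha>s :: "('Ah \<times> 'n list) list"
    and \<phi> :: "('Fh, 'n) fml"
    and k :: nat
  assumes "is_bat Dh" and "is_bat Dl"
    and "refinement_mapping TYPE('ul) Dh Dl m"
    and "sound_abstraction TYPE('uh) TYPE('ul) Dh Dl m"
    and "\<forall>\<alpha> \<in> set \<alpha>s. ground_action Dh \<alpha>"
    and "wf_fml Dh k \<phi>"
    and "entails Dh (\<lambda>(M :: ('Ah, 'Fh, 'n, 'uh) interp) v.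
           Executable M (do_list M \<alpha>s (S0 M)) \<and> sat M v (do_list M \<alpha>s (S0 M)) \<phi>)"
  shows "entails_C Dl (\<lambda>(M :: ('Al, 'Fl, 'n, 'ul) cinterp) v.
           \<exists>s \<in> Sit M. Do M v (m_seq m \<alpha>s) (S0 M) s \<and> sat M v s (m_fml m \<phi>))"
  unfolding entails_C_def
proof (intro allI impI)
  fix Ml :: "('Al, 'Fl, 'n, 'ul) cinterp" and v
  assume Ml: "is_model_C Dl Ml"
  obtain Mh :: "('Ah, 'Fh, 'n, 'uh) interp" and B
    where Mh: "is_model Dh Mh" and B: "m_bisimulation Dh m Mh Ml B" and S0: "(S0 Mh, S0 Ml) \<in> B"
    using assms(4) Ml unfolding sound_abstraction_def m_bisimilar_def by blast
  let ?sh = "do_list Mh \<alpha>s (S0 Mh)"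
  \<comment> \<open>The assignment \<open>v\<close> serves for \<open>Mh\<close> too, since both
    models range over the standard names.\<close>
  have exec: "Executable Mh ?sh" and sat: "sat Mh v ?sh \<phi>"
    using assms(7) Mh unfolding entails_def by auto
  obtain sl where sl: "sl \<in> Sit Ml" "Do Ml v (m_seq m \<alpha>s) (S0 Ml) sl" "(?sh, sl) \<in> B"
    using Do_m_seq_bisimulation[OF Mh Ml B S0 assms(5) exec] by blast
  then have iso: "m_isomorphic Dh m Mh Ml ?sh sl"
    using B unfolding m_bisimulation_def by blast
  have "sat Ml v sl (m_fml m \<phi>)" using sat by (simp add: sat_m_fml[OF iso assms(6)])
  then show "\<exists>s \<in> Sit Ml. Do Ml v (m_seq m \<alpha>s) (S0 Ml) s \<and> sat Ml v s (m_fml m \<phi>)"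
    using sl by blast
qed

end
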